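(* There exists an instance of the product ranking problem with $n=2$ products (that is, click probabilities $\mu_1>\mu_2$ and an exit probability $q_1$) and a strategy for the fake users employing $F=O(\log^2 T)$ fake users which causes the UCB algorithm to incur $\Omega(T)$ regret. Explicitly: there exist $\mu_1>\mu_2$ in $[0,1]$, $q_1\in[0,1]$ and constants $c,C,T_0>0$ such that for every $T\ge T_0$ there is a fake-user policy $\mathbf P=(P_t)_{t=1}^T$ with fakeness budget $F\le C\log^2 T$ under which the regret of the UCB algorithm satisfies $\mathrm{Reg}_T(\mathbf P)\ge cT$.
   Context: **Model.** There are $n$ products $[n]=\{1,\dots,n\}$, a horizon of $T$ rounds, click probabilities $\mu_1>\mu_2>\dots>\mu_n$ in $[0,1]$, and exit probabilities $q_1,\dots,q_{n-1}\in[0,1]$, all unknown to the platform. A ranking $\pi$ is a permutation; $\pi(j)=i$ means that product $i$ is in position $j$. In round $t$ the platform shows a ranking $\pi_t$ to one customer. A *real* customer examines positions $1,2,\dots$ in order; when examining the product $i$ in position $j$ she clicks on it with probability $\mu_i$ (independently of everything else) and then stops at position $j$; if she does not click, she exits at position $j$ with probability $q_j$ (independently) and otherwise moves to position $j+1$ (after position $n$ she exits). The platform observes $c_t\in(\{\emptyset\}\cup[n])\times[n]$: the clicked product (if any) and the exit position (the last examined position). The algorithm "receives feedback" on product $i$ in round $t$ if the position of $i$ in $\pi_t$ is at most the exit position. **Fake users.** Let $f_t=1$ if the user in round $t$ is fake and $f_t=0$ otherwise, and $\mathcal H_t=\{(\pi_s,f_s,c_s)\}_{s\le t}$. A fake-user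 policy $\mathbf P=(P_t)_{t=1}^T$ maps each $\mathcal H_{t-1}$ to a (possibly randomized) action in round $t$: whether the user in round $t$ is fake and, if so, which (at most one) product is clicked (she then exits at that product's position) or, if none is clicked, at which position she exits. The platform does not observe $f_t$. The fakeness budget $F$ bounds the number of rounds with a fake user: $\sum_t f_t\le F$ always. **Regret.** $\mathcal C_{r,t}(\pi)=1$ if the customer in round $t$ is real and clicks on some product when shown $\pi$, and $0$ otherwise. Let $\pi^\star(i)=i$ for all $i$ (the optimal ranking). For an algorithm choosing rankings $(\pi_t)$ and a policy $\mathbf P$, $$\mathrm{Reg}_T(\mathbf P)=\mathbb E\Big[\sum_{t=1}^T\mathcal C_{r,t}(\pi^\star)\Big]-\mathbb E\Big[\sum_{t=1}^T\mathcal C_{r,t}(\pi_t)\Big],$$ where the first expectation is over the history generated when $\pi^\star$ is shown in every round and the second over the history generated by the algorithm (both against $\mathbf P$). **UCB algorithm (two products).** The algorithm maintains for each product $i\in\{1,2\}$ the feedback count $\eta_i$ (number of rounds so far in which feedback on $i$ was received) and the empirical mean $\hat\mu_i$ (fraction of those rounds in which $i$ was clicked). In each round it places in the top position the product with the largest index $\mathrm{UCB}_i=\hat\mu_i+\sqrt{\log T/\eta_i}$ (equal to $+\infty$ if $\eta_i=0$), ties being broken by an arbitrary fixed rule, and the other product in position 2. Here $\log$ is the natural logarithm. *)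

theory Defs
  imports "HOL-Probability.Probability" "HOL-Combinatorics.Combinatorics"
begin

text \<open>
  Products and positions are the numbers in \<open>{1..n}\<close>. A ranking is a permutation
  (\<open>\<pi> permutes {1..n}\<close>), where \<open>\<pi> j\<close> is the product in position \<open>j\<close>, so that
  \<open>inv \<pi> i\<close> is the position of product \<open>i\<close>.
\<close>

type_synonym ranking = "nat \<Rightarrow> nat"

text \<open>The clicked product, if any, and the exit position.\<close>

type_synonym feedback = "nat option \<times> nat"

text \<open>
  Histories are in chronological order. A full history records (ranking, whether the user
  was fake, feedback) for each round; the platform only sees the rankings and the feedback.
\<close>

type_synonym history = "(ranking \<times> bool \<times> feedback) list"

type_synonym observed_history = "(ranking \<times> feedback) list"

definition observe :: "history \<Rightarrow> observed_history" where
  "observe h = map (\<lambda>(\<pi>, f, c). (\<pi>, c)) h"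

definition instance_params :: "nat \<Rightarrow> (nat \<Rightarrow> real) \<Rightarrow> (nat \<Rightarrow> real) \<Rightarrow> bool" where
  "instance_params n \<mu> q \<longleftrightarrow>
     (\<forall>i\<in>{1..n}. 0 \<le> \<mu> i \<and> \<mu> i \<le> 1) \<and>
     (\<forall>i\<in>{1..n}. \<forall>j\<in>{1..n}. i < j \<longrightarrow> \<mu> j < \<mu> i) \<and>
     (\<forall>j\<in>{1..<n}. 0 \<le> q j \<and> q j \<le> 1)"

text \<open>
  A real customer who is about to examine position \<open>j\<close>, with \<open>k\<close> further positions after it.
\<close>

fun examine ::
  "(nat \<Rightarrow> real) \<Rightarrow> (nat \<Rightarrow> real) \<Rightarrow> ranking \<Rightarrow> nat \<Rightarrow> nat \<Rightarrow> feedback pmf" where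
  "examine \<mu> q \<pi> j k = do {
     click \<leftarrow> bernoulli_pmf (\<mu> (\<pi> j));
     if click then return_pmf (Some (\<pi> j), j)
     else (case k of
         0 \<Rightarrow> return_pmf (None, j)
       | Suc k' \<Rightarrow> do {
           leave \<leftarrow> bernoulli_pmf (q j);
           if leave then return_pmf (None, j) else examine \<mu> q \<pi> (Suc j) k'
         })
   }"

declare examine.simps [simp del]

definition real_customer ::
  "nat \<Rightarrow> (nat \<Rightarrow> real) \<Rightarrow> (nat \<Rightarrow> real) \<Rightarrow> ranking \<Rightarrow> feedback pmf" where
  "real_customer n \<mu> q \<pi> = examine \<mu> q \<pi> 1 (n - 1)"

text \<open>
  \<open>Fake_Click i\<close>: a fake user who clicks product \<open>i\<close> and exits at its position, wherever it
  is shown. \<open>Fake_Exit j\<close>: a fake user who exits at position \<open>j\<close> without a click.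
\<close>

datatype action = No_Fake | Fake_Click nat | Fake_Exit nat

text \<open>
  \<open>P t h\<close> is the distribution of the action in round \<open>t \<in> {1..T}\<close> after the history \<open>h\<close>
  of rounds \<open>1, \<dots>, t - 1\<close>.
\<close>

type_synonym policy = "nat \<Rightarrow> history \<Rightarrow> action pmf"

definition fake_policy :: "nat \<Rightarrow> nat \<Rightarrow> policy \<Rightarrow> bool" where
  "fake_policy n T P \<longleftrightarrow>
     (\<forall>t\<in>{1..T}. \<forall>h. set_pmf (P t h)
        \<subseteq> insert No_Fake (Fake_Click ` {1..n} \<union> Fake_Exit ` {1..n}))"

fun respond ::
  "nat \<Rightarrow> (nat \<Rightarrow> real) \<Rightarrow> (nat \<Rightarrow> real) \<Rightarrow> ranking \<Rightarrow> action \<Rightarrow> (bool \<times> feedback) pmf" where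
  "respond n \<mu> q \<pi> No_Fake = map_pmf (Pair False) (real_customer n \<mu> q \<pi>)"
| "respond n \<mu> q \<pi> (Fake_Click i) = return_pmf (True, Some i, inv \<pi> i)"
| "respond n \<mu> q \<pi> (Fake_Exit j) = return_pmf (True, None, j)"

type_synonym algorithm = "observed_history \<Rightarrow> ranking pmf"

definition ranking_algorithm :: "nat \<Rightarrow> algorithm \<Rightarrow> bool" where
  "ranking_algorithm n A \<longleftrightarrow> (\<forall>h. set_pmf (A h) \<subseteq> {\<pi>. \<pi> permutes {1..n}})"

text \<open>
  The distribution of the history of the first \<open>t\<close> rounds. Given the past, the action of the
  policy and the ranking of the platform are drawn independently of each other.
\<close>

primrec run ::
  "nat \<Rightarrow> (nat \<Rightarrow> real) \<Rightarrow> (nat \<Rightarrow> real) \<Rightarrow> algorithm \<Rightarrow> policy \<Rightarrow> nat \<Rightarrow> history pmf" where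
  "run n \<mu> q A P 0 = return_pmf []"
| "run n \<mu> q A P (Suc t) = do {
     h \<leftarrow> run n \<mu> q A P t;
     \<pi> \<leftarrow> A (observe h);
     a \<leftarrow> P (Suc t) h;
     (f, c) \<leftarrow> respond n \<mu> q \<pi> a;
     return_pmf (h @ [(\<pi>, f, c)])
   }"

definition num_fake :: "history \<Rightarrow> nat" where
  "num_fake h = length (filter (\<lambda>(\<pi>, f, c). f) h)"

text \<open>
  The budget must hold surely for the policy on its own, whatever rankings
  the platform shows.
\<close>

definition fakeness_budget ::
  "nat \<Rightarrow> (nat \<Rightarrow> real) \<Rightarrow> (nat \<Rightarrow> real) \<Rightarrow> nat \<Rightarrow> policy \<Rightarrow> nat \<Rightarrow> bool" where
  "fakeness_budget n \<mu> q T P F \<longleftrightarrow>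
     (\<forall>A. ranking_algorithm n A \<longrightarrow> (\<forall>h\<in>set_pmf (run n \<mu> q A P T). num_fake h \<le> F))"

definition real_clicks :: "history \<Rightarrow> nat" where
  "real_clicks h = length (filter (\<lambda>(\<pi>, f, c). \<not> f \<and> fst c \<noteq> None) h)"

definition optimal_algorithm :: algorithm where
  "optimal_algorithm h = return_pmf id"

definition regret ::
  "nat \<Rightarrow> (nat \<Rightarrow> real) \<Rightarrow> (nat \<Rightarrow> real) \<Rightarrow> nat \<Rightarrow> algorithm \<Rightarrow> policy \<Rightarrow> real" where
  "regret n \<mu> q T A P =
     measure_pmf.expectation (run n \<mu> q optimal_algorithm P T) real_clicks
     - measure_pmf.expectation (run n \<mu> q A P T) real_clicks"

definition feedback_count :: "nat \<Rightarrow> observed_history \<Rightarrow> nat" where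
  "feedback_count i h = length (filter (\<lambda>(\<pi>, c). inv \<pi> i \<le> snd c) h)"

definition empirical_mean :: "nat \<Rightarrow> observed_history \<Rightarrow> real" where
  "empirical_mean i h =
     real (length (filter (\<lambda>(\<pi>, c). inv \<pi> i \<le> snd c \<and> fst c = Some i) h))
     / real (feedback_count i h)"

definition ucb_index :: "nat \<Rightarrow> nat \<Rightarrow> observed_history \<Rightarrow> ereal" where
  "ucb_index T i h =
     (if feedback_count i h = 0 then \<infinity>
      else ereal (empirical_mean i h + sqrt (ln (real T) / real (feedback_count i h))))"

text \<open>
  The tie-breaking rule \<open>tie\<close> says, as a function of the observed history, whether
  product 1 is put on top when the two indices are equal.
\<close>

definition ucb :: "nat \<Rightarrow> (observed_history \<Rightarrow> bool) \<Rightarrow> algorithm" where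
  "ucb T tie h = return_pmf
     (if ucb_index T 2 h < ucb_index T 1 h \<or> (ucb_index T 1 h = ucb_index T 2 h \<and> tie h)
      then id else Transposition.transpose 1 2)"

end

theory Submission
  imports Defs "HOL-Real_Asymp.Real_Asymp"
begin

text \<open>
  Take \<open>\<mu>\<^sub>1 = 1\<close>, \<open>\<mu>\<^sub>2 = 1/2\<close> and \<open>q\<^sub>1 = 1\<close>, so that only the product on top is ever examined
  by a real customer. The attacker can predict the ranking, and while the budget \<open>a + 1\<close> lasts he
  makes a fake user exit without a click each time product 1 is on top. Until the budget is spent,
  product 1 has only non-clicks and real customers only see product 2. Spending the last fake user
  requires that product 1 is on top after \<open>a \<ge> 16 log T\<close> non-clicks, where its index is at most
  \<open>1/4\<close>; so product 2 must have been clicked by at most a quarter of the at least \<open>a\<close>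
  customers who saw it. If \<open>S\<close> of \<open>k\<close> customers have clicked product 2, then
  \<open>(4/3)\<^sup>k / 2\<^sup>S\<close> is a martingale that is at least 2 in that event, which therefore has
  probability at most \<open>1/2\<close>. So at most \<open>3/4 T\<close> clicks are expected. In fact a budget
  of order \<open>log T\<close> is enough.
\<close>

section \<open>The instance and its customers\<close>

definition click_prob :: "nat \<Rightarrow> real" where
  "click_prob i = (if i = 1 then 1 else 1 / 2)"

definition exit_prob :: "nat \<Rightarrow> real" where
  "exit_prob j = 1"

lemma instance_params_click_exit: "instance_params 2 click_prob exit_prob"
  by (auto simp: instance_params_def click_prob_def exit_prob_def)

lemma bernoulli_pmf_1 [simp]: "bernoulli_pmf 1 = return_pmf True"
  by (rule pmf_eqI) (auto simp: indicator_def split: if_splits)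

lemma real_customer_id: "real_customer 2 click_prob exit_prob id = return_pmf (Some 1, 1)"
  by (simp add: real_customer_def examine.simps click_prob_def bind_return_pmf)

lemma real_customer_transpose:
  "real_customer 2 click_prob exit_prob (Transposition.transpose 1 2) =
     map_pmf (\<lambda>b. (if b then Some 2 else None, 1)) (bernoulli_pmf (1 / 2))"
  unfolding real_customer_def map_pmf_def
  by (simp add: examine.simps click_prob_def exit_prob_def bind_return_pmf numeral_2_eq_2)
    (intro bind_pmf_cong; simp add: exit_prob_def bind_return_pmf)

section \<open>Runs, counters and expectations over finite supports\<close>

lemma run_snoc_cases:
  assumes "h' \<in> set_pmf (run n \<mu> q A P (Suc t))"
  obtains h \<pi> a f c where "h \<in> set_pmf (run n \<mu> q A P t)" "\<pi> \<in> set_pmf (A (observe h))"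
    "a \<in> set_pmf (P (Suc t) h)" "(f, c) \<in> set_pmf (respond n \<mu> q \<pi> a)" "h' = h @ [(\<pi>, f, c)]"
  using assms by (auto simp: split_beta)

lemma num_fake_simps [simp]:
  "num_fake [] = 0"
  "num_fake (h @ [(\<pi>, f, c)]) = num_fake h + (if f then 1 else 0)"
  by (auto simp: num_fake_def)

lemma real_clicks_simps [simp]:
  "real_clicks [] = 0"
  "real_clicks (h @ [(\<pi>, f, c)]) = real_clicks h + (if \<not> f \<and> fst c \<noteq> None then 1 else 0)"
  by (auto simp: real_clicks_def)

lemma respond_fake_iff:
  assumes "(f, c) \<in> set_pmf (respond n \<mu> q \<pi> a)"
  shows "f \<longleftrightarrow> a \<noteq> No_Fake"
  using assms by (cases a) auto

lemma expectation_bind_finite: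
  fixes g :: "'b \<Rightarrow> real"
  assumes "finite (set_pmf p)" "\<And>x. x \<in> set_pmf p \<Longrightarrow> finite (set_pmf (f x))"
  shows "measure_pmf.expectation (p \<bind> f) g =
    measure_pmf.expectation p (\<lambda>x. measure_pmf.expectation (f x) g)"
proof -
  have "measure_pmf.expectation (p \<bind> f) g =
      (\<Sum>a\<in>set_pmf p. pmf p a *\<^sub>R measure_pmf.expectation (f a) g)"
    using assms by (intro pmf_expectation_bind) auto
  also have "\<dots> = measure_pmf.expectation p (\<lambda>x. measure_pmf.expectation (f x) g)"
    using assms by (subst integral_measure_pmf[of "set_pmf p"]) auto
  finally show ?thesis .
qed

lemma expectation_mono_finite:
  fixes g g' :: "'b \<Rightarrow> real"
  assumes "finite (set_pmf p)" "\<And>x. x \<in> set_pmf p \<Longrightarrow> g x \<le> g' x"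
  shows "measure_pmf.expectation p g \<le> measure_pmf.expectation p g'"
  using assms by (intro integral_mono_AE integrable_measure_pmf_finite) (auto simp: AE_measure_pmf_iff)

text \<open>There is at most one halving per full group of four factors 4/3, and (4/3)^4 = 256/81
  exceeds 3, so each group contributes at least 3/2. Two groups suffice because (3/2)^2 =
  9/4.\<close>

lemma power_four_thirds_ge:
  fixes k S :: nat
  assumes "8 \<le> k" "4 * S \<le> k"
  shows "2 \<le> (4 / 3 :: real) ^ k / 2 ^ S"
proof -
  define m where "m = k div 4"
  have m: "2 \<le> m" "S \<le> m" "4 * m \<le> k" using assms by (auto simp: m_def)
  have "(2::real) \<le> (3 / 2) ^ 2" by (simp add: power2_eq_square)
  also have "\<dots> \<le> (3 / 2) ^ m" using m by (intro power_increasing) auto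
  also have "\<dots> = 3 ^ m / 2 ^ m" by (simp add: power_divide)
  also have "\<dots> \<le> ((4 / 3) ^ 4) ^ m / 2 ^ S"
    using m by (intro frac_le power_mono power_increasing) (auto simp: power4_eq_xxxx)
  also have "\<dots> \<le> (4 / 3) ^ k / 2 ^ S"
    using m by (intro divide_right_mono) (auto simp flip: power_mult intro!: power_increasing)
  finally show ?thesis .
qed

section \<open>The attack with budget \<open>a + 1\<close>\<close>

locale ucb_attack =
  fixes T a :: nat and tie :: "observed_history \<Rightarrow> bool"
  assumes ln_T: "1 \<le> ln (real T)" and a_ge: "16 * ln (real T) \<le> real a"
begin

definition ucb_ranking :: "observed_history \<Rightarrow> ranking" where
  "ucb_ranking h =
     (if ucb_index T 2 h < ucb_index T 1 h \<or> (ucb_index T 1 h = ucb_index T 2 h \<and> tie h)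
      then id else Transposition.transpose 1 2)"

lemma ucb_eq: "ucb T tie h = return_pmf (ucb_ranking h)"
  by (simp add: ucb_def ucb_ranking_def)

text \<open>A policy is not given the current ranking, but UCB is deterministic, so the ranking can
  be recomputed from the observed history. Against another algorithm this prediction may be wrong;
  the test on \<open>num_fake\<close> still enforces the budget.\<close>

definition attack :: "history \<Rightarrow> action" where
  "attack h = (if num_fake h \<le> a \<and> ucb_ranking (observe h) = id then Fake_Exit 1 else No_Fake)"

definition attack_policy :: policy where
  "attack_policy t h = return_pmf (attack h)"

lemma fake_policy_attack: "fake_policy 2 T attack_policy"
  by (auto simp: fake_policy_def attack_policy_def attack_def)

lemma num_fake_attack:
  assumes "h \<in> set_pmf (run n \<mu> q A attack_policy t)"
  shows "num_fake h \<le> Suc a"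
  using assms
proof (induction t arbitrary: h)
  case (Suc t)
  from Suc.prems show ?case
  proof (cases rule: run_snoc_cases)
    case (1 h0 \<pi> b f c)
    then show ?thesis
      using Suc.IH[of h0] respond_fake_iff[OF 1(4)]
      by (auto simp: attack_policy_def attack_def split: if_splits)
  qed
qed auto

lemma fakeness_budget_attack: "fakeness_budget 2 \<mu> q T attack_policy (Suc a)"
  using num_fake_attack by (auto simp: fakeness_budget_def)

text \<open>A real customer who sees product 1 first always clicks and the attack never does, so
  each round is either fake or a real click, whatever UCB would have shown.\<close>

lemma optimal_run:
  assumes "h \<in> set_pmf (run 2 click_prob exit_prob optimal_algorithm attack_policy t)"
  shows "real_clicks h + num_fake h = t"
  using assms
proof (induction t arbitrary: h)
  case (Suc t)
  from Suc.prems show ?case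
  proof (cases rule: run_snoc_cases)
    case (1 h0 \<pi> b f c)
    then show ?thesis
      using Suc.IH[of h0]
      by (cases b) (auto simp: attack_policy_def attack_def optimal_algorithm_def
          real_customer_id split: if_splits)
  qed
qed auto

section \<open>Rounds of UCB under the attack\<close>

definition outcome :: "history \<Rightarrow> (ranking \<times> bool \<times> feedback) pmf" where
  "outcome h = map_pmf (Pair (ucb_ranking (observe h)))
     (respond 2 click_prob exit_prob (ucb_ranking (observe h)) (attack h))"

text \<open>Product 1 is on top in \<open>fake\<close> and \<open>exhausted\<close>. In
  \<open>real\<close>, product 2 is on top, and the budget may or may not be spent.\<close>

lemma outcome_cases:
  obtains
    (fake) "num_fake h \<le> a" "ucb_ranking (observe h) = id" "outcome h = return_pmf (id, True, None, 1)"
  | (exhausted) "num_fake h > a" "outcome h = return_pmf (id, False, Some 1, 1)"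
  | (real) "outcome h = map_pmf (\<lambda>b. (Transposition.transpose 1 2, False, if b then Some 2 else None, 1))
      (bernoulli_pmf (1 / 2))"
proof (cases "ucb_ranking (observe h) = id")
  case True
  then show ?thesis using that(1,2)
    by (cases "num_fake h \<le> a") (auto simp: outcome_def attack_def real_customer_id)
next
  case False
  then have *: "ucb_ranking (observe h) = Transposition.transpose 1 2"
    by (auto simp: ucb_ranking_def split: if_splits)
  with False show ?thesis
    by (intro that(3))
      (simp add: outcome_def attack_def real_customer_transpose[simplified] pmf.map_comp o_def)
qed

abbreviation ucb_run :: "nat \<Rightarrow> history pmf" where
  "ucb_run \<equiv> run 2 click_prob exit_prob (ucb T tie) attack_policy"

lemma ucb_run_Suc:
  "ucb_run (Suc t) = ucb_run t \<bind> (\<lambda>h. map_pmf (\<lambda>x. h @ [x]) (outcome h))"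
  by (simp add: ucb_eq attack_policy_def bind_return_pmf outcome_def map_pmf_def bind_assoc_pmf
      case_prod_unfold)

lemma finite_outcome: "finite (set_pmf (outcome h))"
  by (cases h rule: outcome_cases) auto

lemma finite_ucb_run: "finite (set_pmf (ucb_run t))"
proof (induction t)
  case (Suc t)
  then show ?case by (simp add: ucb_run_Suc finite_outcome del: run.simps(2))
qed auto

lemma expectation_ucb_run_Suc:
  fixes g :: "history \<Rightarrow> real"
  shows "measure_pmf.expectation (ucb_run (Suc t)) g =
    measure_pmf.expectation (ucb_run t)
      (\<lambda>h. measure_pmf.expectation (outcome h) (\<lambda>x. g (h @ [x])))"
  unfolding ucb_run_Suc
  by (subst expectation_bind_finite) (auto simp: finite_ucb_run finite_outcome)

text \<open>The possible rounds other than a click on product 1, which occurs only once the budget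
  is spent.\<close>

definition typical :: "(ranking \<times> bool \<times> feedback) set" where
  "typical = {(id, True, None, 1), (Transposition.transpose 1 2, False, None, 1),
     (Transposition.transpose 1 2, False, Some 2, 1)}"

lemma ucb_run_typical:
  assumes "h \<in> set_pmf (ucb_run t)" "num_fake h \<le> a"
  shows "set h \<subseteq> typical"
  using assms
proof (induction t arbitrary: h)
  case (Suc t)
  then obtain h0 x where h: "h0 \<in> set_pmf (ucb_run t)" "x \<in> set_pmf (outcome h0)" "h = h0 @ [x]"
    by (auto simp: ucb_run_Suc simp del: run.simps(2))
  then have le: "num_fake h0 \<le> a" using Suc.prems by (cases x) auto
  have "x \<in> typical"
    using h le by (cases h0 rule: outcome_cases) (auto simp: typical_def split: if_splits)
  with Suc.IH[OF h(1) le] h(3) show ?case by auto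
qed auto

text \<open>Typical users all exit at position 1, so only the top product receives feedback: product
  1 from fake users, product 2 from real ones. If there is no fake user yet, the mean of product 1
  is 0 because 0 / 0 = 0.\<close>

lemma typical_counts:
  assumes "set h \<subseteq> typical"
  shows "feedback_count 1 (observe h) = num_fake h"
    and "feedback_count 2 (observe h) = length h - num_fake h"
    and "empirical_mean 1 (observe h) = 0"
    and "empirical_mean 2 (observe h) = real (real_clicks h) / real (length h - num_fake h)"
proof -
  \<comment> \<open>The count of product 2 is stated as a sum to keep truncated subtraction out of
    the induction.\<close>
  have "feedback_count 1 (observe h) = num_fake h \<and>
    feedback_count 2 (observe h) + num_fake h = length h \<and>
    length (filter (\<lambda>(\<pi>, c). inv \<pi> 1 \<le> snd c \<and> fst c = Some 1) (observe h)) = 0 \<and>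
    length (filter (\<lambda>(\<pi>, c). inv \<pi> 2 \<le> snd c \<and> fst c = Some 2) (observe h)) = real_clicks h" (is "?P h")
    using assms
  proof (induction h)
    case (Cons x h)
    then have IH: "?P h" and "x \<in> typical" by auto
    then consider "x = (id, True, None, 1)" | "x = (Transposition.transpose 1 2, False, None, 1)"
      | "x = (Transposition.transpose 1 2, False, Some 2, 1)"
      unfolding typical_def by blast
    then show ?case using IH
      by cases (simp_all add: feedback_count_def observe_def num_fake_def real_clicks_def)
  qed (simp add: feedback_count_def observe_def num_fake_def real_clicks_def)
  then show "feedback_count 1 (observe h) = num_fake h"
    and "feedback_count 2 (observe h) = length h - num_fake h"
    and "empirical_mean 1 (observe h) = 0"
    and "empirical_mean 2 (observe h) = real (real_clicks h) / real (length h - num_fake h)"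
    by (auto simp: empirical_mean_def)
qed

section \<open>The supermartingale\<close>

definition weight :: "history \<Rightarrow> real" where
  "weight h = (4 / 3) ^ (length h - num_fake h) / 2 ^ real_clicks h"

text \<open>Here the last fake user is about to be spent. Product 1 has mean 0, so its bonus alone
  dominates both summands of the index of product 2: the bonus, which forces many views, and the
  mean, which forces few clicks.\<close>

lemma weight_at_exhaustion:
  assumes typical: "set h \<subseteq> typical" and a: "num_fake h = a" and top: "ucb_ranking (observe h) = id"
  shows "2 \<le> weight h"
proof -
  define k S L where "k = length h - num_fake h" and "S = real_clicks h" and "L = ln (real T)"
  have L: "1 \<le> L" "16 * L \<le> real a" using ln_T a_ge by (auto simp: L_def)
  then have a0: "0 < a" by (cases a) auto
  have "ucb_index T 2 (observe h) \<le> ucb_index T 1 (observe h)"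
  proof (rule ccontr)
    assume "\<not> ?thesis"
    then have "ucb_ranking (observe h) = Transposition.transpose 1 2"
      by (auto simp: ucb_ranking_def)
    with top have "Transposition.transpose 1 2 = (id :: ranking)" by simp
    then have "Transposition.transpose 1 2 (1::nat) = id 1" by metis
    then show False by simp
  qed
  \<comment> \<open>An unseen product 2 would have infinite index, whereas that of product 1 is
    finite since \<open>a\<close> is positive.\<close>
  then have k: "k \<noteq> 0" and le: "real S / real k + sqrt (L / real k) \<le> sqrt (L / real a)"
    using a0 typical_counts[OF typical] a by (auto simp: ucb_index_def k_def S_def L_def split: if_splits)
  have "0 \<le> real S / real k" "0 \<le> sqrt (L / real k)" using L by auto
  then have *: "sqrt (L / real k) \<le> sqrt (L / real a)" "real S / real k \<le> sqrt (L / real a)"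
    using le by linarith+
  have "a \<le> k" using *(1) L a0 k by (simp add: divide_simps)
  moreover have "4 * S \<le> k"
  proof -
    \<comment> \<open>This is what the factor 16 in \<open>a_ge\<close> is for.\<close>
    have "sqrt (L / real a) \<le> 1 / 4"
      using L a0 by (intro real_le_lsqrt) (simp_all add: divide_simps power2_eq_square)
    then have "real S / real k \<le> 1 / 4" using *(2) by linarith
    then show ?thesis using k by (simp add: divide_simps)
  qed
  moreover have "8 \<le> a" using L by linarith
  ultimately show ?thesis
    unfolding weight_def k_def[symmetric] S_def[symmetric] by (intro power_four_thirds_ge) auto
qed

text \<open>The weight, stopped when the budget is spent and then lowered to 2, the bound of
  \<open>weight_at_exhaustion\<close>.\<close>

definition potential :: "history \<Rightarrow> real" where
  "potential h = (if num_fake h \<le> a then weight h else 2)"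

text \<open>A fake round leaves the weight unchanged, except that the last one lowers it to 2. A
  customer shown product 2 multiplies it by 4/3 or 2/3 with equal probability, hence by 1 on
  average, while budget remains.\<close>

lemma potential_step:
  assumes h: "h \<in> set_pmf (ucb_run t)"
  shows "measure_pmf.expectation (outcome h) (\<lambda>x. potential (h @ [x])) \<le> potential h"
proof (cases h rule: outcome_cases)
  case fake
  show ?thesis
  proof (cases "num_fake h = a")
    case True
    with fake show ?thesis using weight_at_exhaustion[OF ucb_run_typical[OF h]]
      by (simp add: potential_def)
  next
    case False
    with fake show ?thesis by (simp add: potential_def weight_def)
  qed
next
  case exhausted
  then show ?thesis by (simp add: potential_def)
next
  case real
  \<comment> \<open>Ensures that the exponent in \<open>weight\<close> really grows by one.\<close>
  have "num_fake h \<le> length h" by (simp add: num_fake_def)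
  with real show ?thesis by (simp add: potential_def weight_def Suc_diff_le field_simps)
qed

lemma potential_nonneg: "0 \<le> potential h"
  by (simp add: potential_def weight_def)

lemma expectation_potential: "measure_pmf.expectation (ucb_run t) potential \<le> 1"
proof (induction t)
  case 0
  then show ?case by (simp add: potential_def weight_def)
next
  case (Suc t)
  have "measure_pmf.expectation (ucb_run (Suc t)) potential
      \<le> measure_pmf.expectation (ucb_run t) potential"
    unfolding expectation_ucb_run_Suc
    by (intro expectation_mono_finite finite_ucb_run potential_step)
  with Suc show ?case by linarith
qed

section \<open>Expected clicks and regret\<close>

lemma real_clicks_step:
  "measure_pmf.expectation (outcome h) (\<lambda>x. real (real_clicks (h @ [x])))
     \<le> real (real_clicks h) + 1 / 2 + potential h / 4"
proof (cases h rule: outcome_cases)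
  case fake
  then show ?thesis using potential_nonneg[of h] by simp
next
  \<comment> \<open>The click is now certain and the potential is 2, so the bound is tight:
    \<open>potential h / 4\<close> stands in for half the indicator of exhaustion, which makes a
    separate Markov inequality unnecessary.\<close>
  case exhausted
  then show ?thesis by (simp add: potential_def)
next
  case real
  then show ?thesis using potential_nonneg[of h] by (simp add: field_simps)
qed

lemma expectation_real_clicks_ucb:
  "measure_pmf.expectation (ucb_run t) (\<lambda>h. real (real_clicks h)) \<le> 3 / 4 * real t"
proof (induction t)
  case (Suc t)
  note [simp] = integrable_measure_pmf_finite[OF finite_ucb_run]
  have "measure_pmf.expectation (ucb_run (Suc t)) (\<lambda>h. real (real_clicks h))
      \<le> measure_pmf.expectation (ucb_run t) (\<lambda>h. real (real_clicks h) + 1 / 2 + potential h / 4)"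
    unfolding expectation_ucb_run_Suc
    by (intro expectation_mono_finite finite_ucb_run real_clicks_step)
  also have "\<dots> = measure_pmf.expectation (ucb_run t) (\<lambda>h. real (real_clicks h)) + 1 / 2
      + measure_pmf.expectation (ucb_run t) potential / 4"
    by simp
  also have "\<dots> \<le> 3 / 4 * real (Suc t)"
    using Suc expectation_potential[of t] by simp
  finally show ?case .
qed auto

lemma expectation_real_clicks_optimal:
  "real T - real (Suc a) \<le> measure_pmf.expectation
     (run 2 click_prob exit_prob optimal_algorithm attack_policy T) (\<lambda>h. real (real_clicks h))"
proof -
  let ?p = "run 2 click_prob exit_prob optimal_algorithm attack_policy T"
  have bounds: "real T - real (Suc a) \<le> real (real_clicks h)" "real (real_clicks h) \<le> real T"
    if "h \<in> set_pmf ?p" for h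
    using optimal_run[OF that] num_fake_attack[OF that] by auto
  have "integrable ?p (\<lambda>h. real (real_clicks h))"
    using bounds(2) by (intro measure_pmf.integrable_const_bound[where B = "real T"])
      (auto simp: AE_measure_pmf_iff)
  then show ?thesis
    using bounds(1) by (intro measure_pmf.integral_ge_const) (auto simp: AE_measure_pmf_iff)
qed

lemma regret_attack:
  "real T / 4 - real (Suc a) \<le> regret 2 click_prob exit_prob T (ucb T tie) attack_policy"
  using expectation_real_clicks_optimal expectation_real_clicks_ucb[of T]
  unfolding regret_def by linarith

end

theorem theorem1:
  shows "\<exists>(\<mu> :: nat \<Rightarrow> real) (q :: nat \<Rightarrow> real) (c :: real) (C :: real) (T0 :: nat).
    instance_params 2 \<mu> q \<and> c > 0 \<and> C > 0 \<and> T0 > 0 \<and>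
    (\<forall>T \<ge> T0. \<forall>tie :: observed_history \<Rightarrow> bool.
      \<exists>(P :: policy) (F :: nat).
        fake_policy 2 T P \<and>
        fakeness_budget 2 \<mu> q T P F \<and>
        real F \<le> C * (ln (real T))\<^sup>2 \<and>
        regret 2 \<mu> q T (ucb T tie) P \<ge> c * real T)"
proof -
  \<comment> \<open>The budget \<open>a + 1\<close> is at most 16 log T + 2. The first condition
    bounds this by 18 log^2 T, the second by T/8, half of the T/4 in
    \<open>regret_attack\<close>.\<close>
  have "eventually (\<lambda>T::nat. 1 \<le> ln (real T) \<and> 16 * ln (real T) + 2 \<le> real T / 8) at_top"
    by (intro eventually_conj; real_asymp)
  then obtain T0 where T0: "1 \<le> ln (real T)" "16 * ln (real T) + 2 \<le> real T / 8" if "T \<ge> T0" for T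
    by (auto simp: eventually_at_top_linorder)
  have "\<exists>P F. fake_policy 2 T P \<and> fakeness_budget 2 click_prob exit_prob T P F \<and>
      real F \<le> 18 * (ln (real T))\<^sup>2 \<and>
      regret 2 click_prob exit_prob T (ucb T tie) P \<ge> 1 / 8 * real T"
    if "T \<ge> max 1 T0" for T tie
  proof -
    define a where "a = nat \<lceil>16 * ln (real T)\<rceil>"
    have T: "1 \<le> ln (real T)" "16 * ln (real T) + 2 \<le> real T / 8" using T0 that by auto
    have a: "16 * ln (real T) \<le> real a" "real a \<le> 16 * ln (real T) + 1"
      using T unfolding a_def by linarith+
    interpret ucb_attack T a tie by unfold_locales (use T a in auto)
    have "ln (real T) \<le> (ln (real T))\<^sup>2" using T by (simp add: power2_eq_square)
    then have "real (Suc a) \<le> 18 * (ln (real T))\<^sup>2" using a T by simp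
    moreover have "1 / 8 * real T \<le> regret 2 click_prob exit_prob T (ucb T tie) attack_policy"
      using regret_attack a T by simp
    ultimately show ?thesis using fake_policy_attack fakeness_budget_attack by blast
  qed
  then show ?thesis
    using instance_params_click_exit
    by (intro exI[of _ click_prob] exI[of _ exit_prob] exI[of _ "1 / 8"] exI[of _ 18]
        exI[of _ "max 1 T0"]) auto
qed

end
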